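(* Let $q\ge 3$ and $n\ge 1$ be integers and let $(T_+,T_-)$ be a pair of disjoint subsets of the vertex set $\mathbb{Z}_q^n$ of the Hamming graph $H(n,q)$. Then the following five conditions (D1)–(D5) on $(T_+,T_-)$ are equivalent. (D1) $T_+$ and $T_-$ are codes with code distance $4$, and there is a matrix $F$ with $q^n$ rows indexed by the vertices of $H(n,q)$ and $3$ columns such that: the first column of $F$ is the characteristic $(0,\pm1)$-function $f$ of $(T_+,T_-)$; in each row of $F$ the entries sum to $0$ and at most $2$ entries are nonzero; and $AF=FS$, where $A$ is the adjacency matrix of $H(n,q)$ and $$S=\begin{pmatrix}0 & n(q-1) & 0\\ 1 & q-2 & (n-1)(q-1)\\ 0 & n & n(q-2)\end{pmatrix}.$$ (D2) $T_+$ and $T_-$ are codes with code distance $4$, and for every $i\in\{1,\ldots,n\}$ the $i$-projection of $(T_+,T_-)$ is a perfect bitrade in $H(n-1,q)$. (D3) For every vertex $x$ of $H(n,q)$, $w_{T_+}(x)=w_{T_-}(x)\le 1$. (D4) $T_+$ and $T_-$ are codes with code distance $4$, and $f=g+h$ for some functions $g,h:\mathbb{Z}_q^n\to\mathbb{C}$ with $Ag=-n\,g$ and $Ah=(q-2)\,h$. (D5) For every vertex $x$ and every $i\in\{1,\ldots,n\}$, $|C_{x,i}\cap T_+|=|C_{x,i}\cap T_-|\le 1$.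
   Context: The Hamming graph $H(m,q)$ has vertex set $\mathbb{Z}_q^m$, two vertices being adjacent iff they differ in exactly one coordinate; $d$ denotes graph (Hamming) distance and $A$ the adjacency matrix, acting on functions $\mathbb{Z}_q^m\to\mathbb{C}$. For a vertex $x$: $S_i(x)=\{y:d(x,y)=i\}$, $B(x)=\{y:d(x,y)\le1\}$. A set of vertices is a code with code distance $d$ if any two distinct elements are at distance at least $d$. The characteristic $(0,\pm1)$-function of a disjoint pair $(T_+,T_-)$ is $f(x)=1$ for $x\in T_+$, $f(x)=-1$ for $x\in T_-$, $f(x)=0$ otherwise. For a set $Z$ of vertices of $H(n,q)$, $w_Z(x)=|S_0(x)\cap Z|+|S_1(x)\cap Z|+\frac{2}{n}|S_2(x)\cap Z|$. For $a\in\mathbb{Z}_q$, $e^a_i$ is the vector with $a$ in position $i$ and $0$ elsewhere; the cylinder is $C_{x,i}=\bigcup_{a\in\mathbb{Z}_q}B(x+e^a_i)$. For $x=(x_1,\ldots,x_{n-1})\in\mathbb{Z}_q^{n-1}$, $i\in\{1,\dots,n\}$, $a\in\mathbb{Z}_q$, let $x^a_i\in\mathbb{Z}_q^n$ be obtained by inserting $a$ at position $i$: $(x_1,\ldots,x_{i-1},a,x_i,\ldots,x_{n-1})$. The $i$-projection of $C\subseteq\mathbb{Z}_q^n$ is $\{x\in\mathbb{Z}_q^{n-1}: x^a_i\in C\text{ for some }a\}$; if $A_+,A_-$ are the $i$-projections of $T_+,T_-$, the $i$-projection of the pair $(T_+,T_-)$ is $(A_+\setminus A_-,\,A_-\setminus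 A_+)$. A perfect bitrade in $H(m,q)$ is a pair $(P_+,P_-)$ of disjoint vertex sets with $|B(x)\cap P_+|=|B(x)\cap P_-|\le1$ for every vertex $x$. A pair satisfying any of (D1)–(D5) is called an extended perfect bitrade. *)

theory Defs
  imports Complex_Main
begin

text \<open>Words of \<open>\<int>\<^sub>q\<^sup>m\<close> are lists of length \<open>m\<close> over the residues \<open>0, \<dots>, q - 1\<close>. Coordinates
  are counted from \<open>0\<close>, so the positions \<open>1, \<dots>, n\<close> become \<open>i < n\<close>.\<close>

type_synonym word = "nat list"

definition words :: "nat \<Rightarrow> nat \<Rightarrow> word set" where
  "words m q = {x. length x = m \<and> set x \<subseteq> {..<q}}"

definition hdist :: "word \<Rightarrow> word \<Rightarrow> nat" where
  "hdist x y = card {i. i < length x \<and> x ! i \<noteq> y ! i}"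

definition adj :: "word \<Rightarrow> word \<Rightarrow> bool" where
  "adj x y \<longleftrightarrow> (\<exists>!i. i < length x \<and> x ! i \<noteq> y ! i)"

definition adj_matrix :: "word \<Rightarrow> word \<Rightarrow> complex" where
  "adj_matrix x y = (if adj x y then 1 else 0)"

definition adj_op :: "nat \<Rightarrow> nat \<Rightarrow> (word \<Rightarrow> complex) \<Rightarrow> word \<Rightarrow> complex" where
  "adj_op m q g x = (\<Sum>y\<in>words m q. adj_matrix x y * g y)"

definition hsphere :: "nat \<Rightarrow> nat \<Rightarrow> nat \<Rightarrow> word \<Rightarrow> word set" where
  "hsphere m q i x = {y \<in> words m q. hdist x y = i}"

definition hball :: "nat \<Rightarrow> nat \<Rightarrow> word \<Rightarrow> word set" where
  "hball m q x = {y \<in> words m q. hdist x y \<le> 1}"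

definition code_with_distance :: "nat \<Rightarrow> word set \<Rightarrow> bool" where
  "code_with_distance d C \<longleftrightarrow> (\<forall>x\<in>C. \<forall>y\<in>C. x \<noteq> y \<longrightarrow> d \<le> hdist x y)"

definition char_fun :: "word set \<Rightarrow> word set \<Rightarrow> word \<Rightarrow> complex" where
  "char_fun Tp Tm x = (if x \<in> Tp then 1 else if x \<in> Tm then - 1 else 0)"

definition weight :: "nat \<Rightarrow> nat \<Rightarrow> word set \<Rightarrow> word \<Rightarrow> real" where
  "weight n q Z x = real (card (hsphere n q 0 x \<inter> Z)) + real (card (hsphere n q 1 x \<inter> Z))
     + 2 / real n * real (card (hsphere n q 2 x \<inter> Z))"

definition word_add :: "nat \<Rightarrow> word \<Rightarrow> word \<Rightarrow> word" where
  "word_add q x y = map2 (\<lambda>a b. (a + b) mod q) x y"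

definition unit_word :: "nat \<Rightarrow> nat \<Rightarrow> nat \<Rightarrow> word" where
  "unit_word n i a = (replicate n 0)[i := a]"

definition cylinder :: "nat \<Rightarrow> nat \<Rightarrow> word \<Rightarrow> nat \<Rightarrow> word set" where
  "cylinder n q x i = (\<Union>a<q. hball n q (word_add q x (unit_word n i a)))"

definition insert_at :: "nat \<Rightarrow> nat \<Rightarrow> word \<Rightarrow> word" where
  "insert_at i a x = take i x @ a # drop i x"

definition proj :: "nat \<Rightarrow> nat \<Rightarrow> nat \<Rightarrow> word set \<Rightarrow> word set" where
  "proj n q i C = {x \<in> words (n - 1) q. \<exists>a<q. insert_at i a x \<in> C}"

definition proj_pair ::
    "nat \<Rightarrow> nat \<Rightarrow> nat \<Rightarrow> word set \<times> word set \<Rightarrow> word set \<times> word set" where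
  "proj_pair n q i = (\<lambda>(Tp, Tm). (proj n q i Tp - proj n q i Tm, proj n q i Tm - proj n q i Tp))"

definition perfect_bitrade :: "nat \<Rightarrow> nat \<Rightarrow> word set \<times> word set \<Rightarrow> bool" where
  "perfect_bitrade m q = (\<lambda>(Pp, Pm).
     Pp \<subseteq> words m q \<and> Pm \<subseteq> words m q \<and> Pp \<inter> Pm = {} \<and>
     (\<forall>x\<in>words m q. card (hball m q x \<inter> Pp) = card (hball m q x \<inter> Pm)
        \<and> card (hball m q x \<inter> Pm) \<le> 1))"

text \<open>Matrices are functions of a row index and a column index; \<open>K\<close> is the finite index set over
  which the product is summed.\<close>

definition mat_prod :: "'k set \<Rightarrow> ('i \<Rightarrow> 'k \<Rightarrow> complex) \<Rightarrow> ('k \<Rightarrow> 'j \<Rightarrow> complex) \<Rightarrow> 'i \<Rightarrow> 'j \<Rightarrow> complex"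
  where "mat_prod K M N i j = (\<Sum>k\<in>K. M i k * N k j)"

definition S_matrix :: "nat \<Rightarrow> nat \<Rightarrow> nat \<Rightarrow> nat \<Rightarrow> complex" where
  "S_matrix n q i j =
    (let n' = of_nat n; q' = of_nat q in
     [[0, n' * (q' - 1), 0],
      [1, q' - 2, (n' - 1) * (q' - 1)],
      [0, n', n' * (q' - 2)]] ! i ! j)"

definition D1 :: "nat \<Rightarrow> nat \<Rightarrow> word set \<Rightarrow> word set \<Rightarrow> bool" where
  "D1 n q Tp Tm \<longleftrightarrow>
     code_with_distance 4 Tp \<and> code_with_distance 4 Tm \<and>
     (\<exists>F :: word \<Rightarrow> nat \<Rightarrow> complex.
        (\<forall>x\<in>words n q. F x 0 = char_fun Tp Tm x) \<and>
        (\<forall>x\<in>words n q. (\<Sum>j<3. F x j) = 0 \<and> card {j. j < 3 \<and> F x j \<noteq> 0} \<le> 2) \<and>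
        (\<forall>x\<in>words n q. \<forall>j<3.
           mat_prod (words n q) adj_matrix F x j = mat_prod {..<3} F (S_matrix n q) x j))"

definition D2 :: "nat \<Rightarrow> nat \<Rightarrow> word set \<Rightarrow> word set \<Rightarrow> bool" where
  "D2 n q Tp Tm \<longleftrightarrow>
     code_with_distance 4 Tp \<and> code_with_distance 4 Tm \<and>
     (\<forall>i<n. perfect_bitrade (n - 1) q (proj_pair n q i (Tp, Tm)))"

definition D3 :: "nat \<Rightarrow> nat \<Rightarrow> word set \<Rightarrow> word set \<Rightarrow> bool" where
  "D3 n q Tp Tm \<longleftrightarrow>
     (\<forall>x\<in>words n q. weight n q Tp x = weight n q Tm x \<and> weight n q Tm x \<le> 1)"

definition D4 :: "nat \<Rightarrow> nat \<Rightarrow> word set \<Rightarrow> word set \<Rightarrow> bool" where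
  "D4 n q Tp Tm \<longleftrightarrow>
     code_with_distance 4 Tp \<and> code_with_distance 4 Tm \<and>
     (\<exists>g h :: word \<Rightarrow> complex.
        (\<forall>x\<in>words n q. char_fun Tp Tm x = g x + h x) \<and>
        (\<forall>x\<in>words n q. adj_op n q g x = - of_nat n * g x) \<and>
        (\<forall>x\<in>words n q. adj_op n q h x = (of_nat q - 2) * h x))"

definition D5 :: "nat \<Rightarrow> nat \<Rightarrow> word set \<Rightarrow> word set \<Rightarrow> bool" where
  "D5 n q Tp Tm \<longleftrightarrow>
     (\<forall>x\<in>words n q. \<forall>i<n. card (cylinder n q x i \<inter> Tp) = card (cylinder n q x i \<inter> Tm)
        \<and> card (cylinder n q x i \<inter> Tm) \<le> 1)"

end

theory Submission
  imports Defs
begin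

text \<open>All five conditions are compared with: \<open>T\<^sub>+\<close> and \<open>T\<^sub>-\<close> have code distance \<open>4\<close>, and
  \<open>\<Sum>\<^sub>i P\<^sub>i f = 0\<close>, where \<open>P\<^sub>i\<close> sums a function over the cylinder \<open>C\<^sub>x\<^sub>,\<^sub>i\<close>. If \<open>L\<^sub>i\<close> sums over the line
  through \<open>x\<close> in direction \<open>i\<close>, then \<open>\<Sum>\<^sub>i L\<^sub>i = A + n\<close> and \<open>P\<^sub>i = L\<^sub>i (A - (q - 2))\<close>, so
  \<open>\<Sum>\<^sub>i P\<^sub>i = (A + n) (A - (q - 2))\<close>: this gives (D4) and (D1). Counting the cylinders around \<open>x\<close>
  that contain a given word shows \<open>\<Sum>\<^sub>i |C\<^sub>x\<^sub>,\<^sub>i \<inter> Z| = n w\<^sub>Z(x)\<close>, which gives (D3). The individual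
  equations \<open>P\<^sub>i f = 0\<close> of (D5) follow from their sum because the \<open>L\<^sub>i\<close> are positive semidefinite:
  if \<open>\<Sum>\<^sub>i L\<^sub>i G = 0\<close> for \<open>G = (A - (q - 2)) f\<close>, then every \<open>L\<^sub>i G = P\<^sub>i f\<close> vanishes. Finally, deleting
  coordinate \<open>i\<close> maps cylinders in direction \<open>i\<close> to balls, which relates (D5) to (D2).\<close>

section \<open>Words, positions of difference and cylinders\<close>

definition diff_pos :: "word \<Rightarrow> word \<Rightarrow> nat set" where
  "diff_pos x y = {i. i < length x \<and> x ! i \<noteq> y ! i}"

lemma hdist_diff_pos: "hdist x y = card (diff_pos x y)"
  by (simp add: hdist_def diff_pos_def)

lemma adj_diff_pos: "adj x y \<longleftrightarrow> card (diff_pos x y) = 1"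
  unfolding adj_def diff_pos_def One_nat_def card_1_singleton_iff set_eq_iff by (simp add: Ex1_def) blast

lemma finite_diff_pos [simp]: "finite (diff_pos x y)"
  by (simp add: diff_pos_def)

lemma diff_pos_subset: "diff_pos x y \<subseteq> {..<length x}"
  by (auto simp: diff_pos_def)

lemma diff_pos_commute: "length x = length y \<Longrightarrow> diff_pos x y = diff_pos y x"
  by (auto simp: diff_pos_def)

lemma diff_pos_refl [simp]: "diff_pos x x = {}"
  by (simp add: diff_pos_def)

lemma diff_pos_empty_iff: "length x = length y \<Longrightarrow> diff_pos x y = {} \<longleftrightarrow> x = y"
  by (auto simp: diff_pos_def list_eq_iff_nth_eq)

lemma diff_pos_triangle: "length x = length y \<Longrightarrow> diff_pos x z \<subseteq> diff_pos x y \<union> diff_pos y z"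
  by (auto simp: diff_pos_def)

text \<open>Lines and cylinders in direction \<open>i\<close> arise by discarding \<open>i\<close>
  from the set of differing positions; this is why the set itself is kept and not only its size. A
  move in direction \<open>i\<close> affects the membership of \<open>i\<close> alone.\<close>

lemma diff_pos_update:
  "i < length x \<Longrightarrow> diff_pos (x[i := a]) z = (diff_pos x z - {i}) \<union> (if a = z ! i then {} else {i})"
  by (auto simp: diff_pos_def nth_list_update split: if_splits)

lemma finite_words [simp]: "finite (words n q)"
  using finite_lists_length_eq[of "{..<q}" n] by (simp add: words_def conj_commute)

lemma length_words: "x \<in> words n q \<Longrightarrow> length x = n"
  by (simp add: words_def)

lemma nth_words: "x \<in> words n q \<Longrightarrow> i < n \<Longrightarrow> x ! i < q"
  by (auto simp: words_def subset_iff)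

lemma update_words: "x \<in> words n q \<Longrightarrow> a < q \<Longrightarrow> x[i := a] \<in> words n q"
  using set_update_subset_insert[of x i a] by (auto simp: words_def)

text \<open>The centres of the balls run through the whole line through \<open>x\<close> in
  direction \<open>i\<close>. For a given \<open>z\<close>, the best centre agrees with
  \<open>z\<close> at \<open>i\<close>, which leaves only the differences elsewhere.\<close>

lemma cylinder_eq:
  assumes x: "x \<in> words n q" and i: "i < n"
  shows "cylinder n q x i = {z \<in> words n q. card (diff_pos x z - {i}) \<le> 1}"
proof -
  note [simp] = length_words[OF x]
  have q: "x ! i < q" using nth_words[OF x i] .
  have add: "word_add q x (unit_word n i a) = x[i := (x ! i + a) mod q]" if "a < q" for a
    using that i nth_words[OF x]
    by (auto simp: word_add_def unit_word_def list_eq_iff_nth_eq nth_list_update)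
  have "cylinder n q x i = (\<Union>a<q. hball n q (x[i := (x ! i + a) mod q]))"
    unfolding cylinder_def using add by simp
  also have "\<dots> = {z \<in> words n q. card (diff_pos x z - {i}) \<le> 1}"
  proof (intro equalityI subsetI)
    fix z assume "z \<in> (\<Union>a<q. hball n q (x[i := (x ! i + a) mod q]))"
    then obtain a where z: "z \<in> words n q" and
      "card (diff_pos (x[i := (x ! i + a) mod q]) z) \<le> 1"
      by (auto simp: hball_def hdist_diff_pos)
    moreover have "card (diff_pos x z - {i}) \<le> card (diff_pos (x[i := (x ! i + a) mod q]) z)"
      by (rule card_mono) (use i in \<open>auto simp: diff_pos_update\<close>)
    ultimately show "z \<in> {z \<in> words n q. card (diff_pos x z - {i}) \<le> 1}" by auto
  next
    fix z assume "z \<in> {z \<in> words n q. card (diff_pos x z - {i}) \<le> 1}"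
    then have z: "z \<in> words n q" and c: "card (diff_pos x z - {i}) \<le> 1" by auto
    \<comment> \<open>The shift that carries \<open>x ! i\<close> to \<open>z ! i\<close> modulo
      \<open>q\<close>; adding \<open>q\<close> first keeps the subtraction of natural numbers from
      truncating.\<close>
    define a where "a = (z ! i + q - x ! i) mod q"
    have "(x ! i + a) mod q = (x ! i + (z ! i + q - x ! i)) mod q"
      by (simp add: a_def mod_simps)
    also have "\<dots> = z ! i" using q nth_words[OF z i] by simp
    finally have "z \<in> hball n q (x[i := (x ! i + a) mod q])"
      using z c i by (simp add: hball_def hdist_diff_pos diff_pos_update)
    moreover have "a < q" using q by (simp add: a_def)
    ultimately show "z \<in> (\<Union>a<q. hball n q (x[i := (x ! i + a) mod q]))" by blast
  qed
  finally show ?thesis .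
qed

lemma finite_cylinder [simp]: "finite (cylinder n q x i)"
  by (auto simp: cylinder_def hball_def)

section \<open>Line sums and the adjacency operator\<close>

definition line_sum :: "nat \<Rightarrow> nat \<Rightarrow> (word \<Rightarrow> complex) \<Rightarrow> word \<Rightarrow> complex" where
  "line_sum q i g x = (\<Sum>a<q. g (x[i := a]))"

text \<open>The kernel form of \<open>L_i\<close>, obtained by identifying the letters
  \<open>a\<close> with the words of the line. The kernel is symmetric in \<open>x\<close> and
  \<open>z\<close>, which matters when sums are exchanged.\<close>

lemma line_sum_eq:
  assumes x: "x \<in> words n q" and i: "i < n"
  shows "line_sum q i g x = (\<Sum>z\<in>words n q. if diff_pos x z - {i} = {} then g z else 0)"
proof -
  note [simp] = length_words[OF x]
  have "bij_betw (\<lambda>a. x[i := a]) {..<q} {z \<in> words n q. diff_pos x z - {i} = {}}"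
    unfolding bij_betw_def
  proof (intro conjI equalityI subsetI)
    show "inj_on (\<lambda>a. x[i := a]) {..<q}"
      using i by (auto intro!: inj_onI dest: arg_cong[where f = "\<lambda>l. l ! i"])
    fix z assume "z \<in> (\<lambda>a. x[i := a]) ` {..<q}"
    then show "z \<in> {z \<in> words n q. diff_pos x z - {i} = {}}"
      using update_words[OF x] by (auto simp: diff_pos_def) (metis nth_list_update_neq)
  next
    fix z assume z: "z \<in> {z \<in> words n q. diff_pos x z - {i} = {}}"
    then have "diff_pos (x[i := z ! i]) z = {}" using i by (simp add: diff_pos_update)
    then have "x[i := z ! i] = z" using z by (subst (asm) diff_pos_empty_iff) (auto simp: length_words)
    moreover have "z ! i < q" using z i by (auto intro: nth_words)
    ultimately show "z \<in> (\<lambda>a. x[i := a]) ` {..<q}" by force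
  qed
  from sum.reindex_bij_betw[OF this, of g] show ?thesis
    by (simp add: line_sum_def sum.inter_filter)
qed

text \<open>This counts the neighbours of \<open>z\<close> on the line. If \<open>z\<close> is on
  the line, these are its other \<open>q - 1\<close> words. If \<open>z\<close> differs from the
  line in one further position, only the word agreeing with \<open>z\<close> at \<open>i\<close> is
  adjacent to it; beyond that there is none.\<close>

lemma sum_adj_matrix_line:
  assumes x: "x \<in> words n q" and i: "i < n" and z: "z \<in> words n q"
  shows "(\<Sum>a<q. adj_matrix (x[i := a]) z) =
    (if diff_pos x z - {i} = {} then of_nat q - 1 else if card (diff_pos x z - {i}) = 1 then 1 else 0)"
proof -
  note [simp] = length_words[OF x]
  define E where "E = diff_pos x z - {i}"
  have "finite E" "i \<notin> E" by (auto simp: E_def)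
  have zi: "z ! i < q" using nth_words[OF z i] .
  have "adj_matrix (x[i := a]) z =
    (if E = {} then (if a = z ! i then 0 else 1) else if card E = 1 \<and> a = z ! i then 1 else 0)" for a
    using i \<open>finite E\<close> \<open>i \<notin> E\<close>
    by (auto simp: adj_matrix_def adj_diff_pos diff_pos_update E_def[symmetric])
  then have "(\<Sum>a<q. adj_matrix (x[i := a]) z) = (\<Sum>a<q.
     if E = {} then 1 - (if a = z ! i then 1 else 0) else
      if card E = 1 then if a = z ! i then 1 else 0 else 0)"
    by (auto intro!: sum.cong)
  also have "\<dots> = (if E = {} then of_nat q - 1 else if card E = 1 then 1 else 0)"
    using zi by (auto simp: sum_subtractf)
  finally show ?thesis by (simp add: E_def)
qed

text \<open>In \<open>L_i A\<close> the words of the line have coefficient \<open>q - 1\<close> and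
  the rest of the cylinder has coefficient 1. Subtracting \<open>q - 2\<close> times the line sum
  makes the coefficient 1 throughout the cylinder.\<close>

lemma line_sum_shifted_adj_op:
  assumes x: "x \<in> words n q" and i: "i < n"
  shows "line_sum q i (\<lambda>y. adj_op n q f y - (of_nat q - 2) * f y) x = (\<Sum>z\<in>cylinder n q x i. f z)"
proof -
  have "line_sum q i (adj_op n q f) x = (\<Sum>z\<in>words n q. (\<Sum>a<q. adj_matrix (x[i := a]) z) * f z)"
    unfolding line_sum_def adj_op_def by (subst sum.swap) (simp add: sum_distrib_right)
  also have "\<dots> = (\<Sum>z\<in>words n q. (of_nat q - 2) * (if diff_pos x z - {i} = {} then f z else 0)
       + (if card (diff_pos x z - {i}) \<le> 1 then f z else 0))"
  proof (rule sum.cong[OF refl])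
    fix z assume z: "z \<in> words n q"
    have c: "card (diff_pos x z - {i}) \<le> 1 \<longleftrightarrow> diff_pos x z - {i} = {} \<or> card (diff_pos x z - {i}) = 1"
      by (simp add: le_Suc_eq)
    show "(\<Sum>a<q. adj_matrix (x[i := a]) z) * f z =
       (of_nat q - 2) * (if diff_pos x z - {i} = {} then f z else 0)
       + (if card (diff_pos x z - {i}) \<le> 1 then f z else 0)"
      unfolding sum_adj_matrix_line[OF x i z] c by (auto simp: algebra_simps)
  qed
  also have "\<dots> = (of_nat q - 2) * line_sum q i f x + (\<Sum>z\<in>cylinder n q x i. f z)"
    by (simp add: line_sum_eq[OF x i] cylinder_eq[OF x i] sum.distrib sum_distrib_left sum.inter_filter)
  finally show ?thesis
    by (simp add: line_sum_def sum_subtractf sum_distrib_left)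
qed

lemma card_index_minus_empty:
  assumes "D \<subseteq> {..<n}"
  shows "card {i. i < n \<and> D - {i} = {}} = (if D = {} then n else if card D = 1 then 1 else 0)"
proof (cases "D = {} \<or> card D = 1")
  case True
  then show ?thesis
  proof
    assume "card D = 1"
    then obtain k where "D = {k}" by (auto simp: card_1_singleton_iff)
    moreover then have "{i. i < n \<and> D - {i} = {}} = {k}" using assms by auto
    ultimately show ?thesis by simp
  qed simp
next
  case False
  have "D - {i} \<noteq> {}" for i
  proof
    assume "D - {i} = {}"
    then have "D \<subseteq> {i}" by blast
    then have "D = {} \<or> D = {i}" by (rule subset_singletonD)
    then show False using False by fastforce
  qed
  then show ?thesis using False by simp
qed

text \<open>Count the lines through \<open>x\<close> that contain \<open>z\<close>: all
  \<open>n\<close> for \<open>z = x\<close>, exactly one for a neighbour, none otherwise.\<close>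

lemma sum_line_sum:
  assumes x: "x \<in> words n q"
  shows "(\<Sum>i<n. line_sum q i g x) = adj_op n q g x + of_nat n * g x"
proof -
  have "(\<Sum>i<n. line_sum q i g x) =
      (\<Sum>i<n. \<Sum>z\<in>words n q. if diff_pos x z - {i} = {} then g z else 0)"
    using line_sum_eq[OF x] by simp
  also have "\<dots> = (\<Sum>z\<in>words n q. of_nat (card {i. i < n \<and> diff_pos x z - {i} = {}}) * g z)"
    by (subst sum.swap) (simp add: sum.If_cases Int_def conj_commute)
  also have "\<dots> = (\<Sum>z\<in>words n q. adj_matrix x z * g z + (if z = x then of_nat n * g x else 0))"
  proof (rule sum.cong[OF refl])
    fix z assume z: "z \<in> words n q"
    have "diff_pos x z \<subseteq> {..<n}" using diff_pos_subset[of x z] length_words[OF x] by simp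
    moreover have "diff_pos x z = {} \<longleftrightarrow> z = x"
      using diff_pos_empty_iff[of x z] length_words[OF x] length_words[OF z] by auto
    ultimately show "of_nat (card {i. i < n \<and> diff_pos x z - {i} = {}}) * g z =
      adj_matrix x z * g z + (if z = x then of_nat n * g x else 0)"
      using card_index_minus_empty[of "diff_pos x z" n]
      by (auto simp: adj_matrix_def adj_diff_pos)
  qed
  also have "\<dots> = adj_op n q g x + of_nat n * g x"
    using x by (simp add: sum.distrib adj_op_def)
  finally show ?thesis .
qed

lemma adj_op_cong: "(\<And>x. x \<in> words n q \<Longrightarrow> g x = h x) \<Longrightarrow> adj_op n q g x = adj_op n q h x"
  by (simp add: adj_op_def)

lemma adj_op_add: "adj_op n q (\<lambda>x. g x + h x) x = adj_op n q g x + adj_op n q h x"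
  by (simp add: adj_op_def algebra_simps sum.distrib)

lemma adj_op_diff: "adj_op n q (\<lambda>x. g x - h x) x = adj_op n q g x - adj_op n q h x"
  by (simp add: adj_op_def algebra_simps sum_subtractf)

lemma adj_op_uminus: "adj_op n q (\<lambda>x. - g x) x = - adj_op n q g x"
  by (simp add: adj_op_def sum_negf)

lemma adj_op_scale: "adj_op n q (\<lambda>x. c * g x) x = c * adj_op n q g x"
  by (simp add: adj_op_def algebra_simps sum_distrib_left)

lemma sum_cylinder_sum:
  assumes x: "x \<in> words n q"
  shows "(\<Sum>i<n. \<Sum>z\<in>cylinder n q x i. f z) =
    adj_op n q (adj_op n q f) x + (of_nat n - (of_nat q - 2)) * adj_op n q f x
      - of_nat n * (of_nat q - 2) * f x"
proof -
  let ?G = "\<lambda>y. adj_op n q f y - (of_nat q - 2) * f y"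
  have "(\<Sum>i<n. \<Sum>z\<in>cylinder n q x i. f z) = (\<Sum>i<n. line_sum q i ?G x)"
    using line_sum_shifted_adj_op[OF x] by simp
  also have "\<dots> = adj_op n q ?G x + of_nat n * ?G x"
    by (rule sum_line_sum[OF x])
  finally show ?thesis unfolding adj_op_diff adj_op_scale by (simp add: algebra_simps)
qed

text \<open>Lying on a common line in direction \<open>i\<close> is a symmetric relation, and each
  word is so related to exactly \<open>q\<close> words.\<close>

lemma sum_words_line_sum:
  assumes i: "i < n"
  shows "(\<Sum>x\<in>words n q. line_sum q i h x) = of_nat q * (\<Sum>x\<in>words n q. h x)"
proof -
  have "(\<Sum>x\<in>words n q. line_sum q i h x) =
     (\<Sum>x\<in>words n q. \<Sum>z\<in>words n q. if diff_pos x z - {i} = {} then h z else 0)"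
    using line_sum_eq[OF _ i] by simp
  also have "\<dots> = (\<Sum>z\<in>words n q. \<Sum>x\<in>words n q. if diff_pos z x - {i} = {} then h z else 0)"
    by (subst sum.swap) (intro sum.cong refl, metis diff_pos_commute length_words)
  also have "\<dots> = (\<Sum>z\<in>words n q. line_sum q i (\<lambda>_. h z) z)"
    using line_sum_eq[OF _ i] by simp
  finally show ?thesis by (simp add: line_sum_def sum_distrib_left)
qed

text \<open>The operators \<open>L\<^sub>i\<close> are positive semidefinite, since \<open>L\<^sub>i\<^sup>2 = q L\<^sub>i\<close>.\<close>
lemma line_sum_eq_0:
  assumes z: "\<And>x. x \<in> words n q \<Longrightarrow> (\<Sum>i<n. line_sum q i g x) = 0"
    and x: "x \<in> words n q" and i: "i < n"
  shows "line_sum q i g x = 0"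
proof -
  \<comment> \<open>\<open>L_i g\<close> is constant on each line in direction \<open>i\<close>, so
    summing \<open>L_i g * cnj g\<close> over a line gives the squared modulus of
    \<open>L_i g\<close>. Summed over \<open>i\<close>, the left-hand sides vanish by assumption,
    hence so does every square.\<close>
  have L: "of_nat q * (\<Sum>x\<in>words n q. line_sum q i g x * cnj (g x)) =
      of_real (\<Sum>x\<in>words n q. (cmod (line_sum q i g x))\<^sup>2)" if "i < n" for i
  proof -
    have "of_nat q * (\<Sum>x\<in>words n q. line_sum q i g x * cnj (g x)) =
      (\<Sum>x\<in>words n q. line_sum q i (\<lambda>x. line_sum q i g x * cnj (g x)) x)"
      using sum_words_line_sum[OF that] by simp
    also have "\<dots> = (\<Sum>x\<in>words n q. of_real ((cmod (line_sum q i g x))\<^sup>2))"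
      by (simp add: line_sum_def complex_norm_square cnj_sum del: of_real_power flip: sum_distrib_left)
    finally show ?thesis by simp
  qed
  have "of_real (\<Sum>i<n. \<Sum>x\<in>words n q. (cmod (line_sum q i g x))\<^sup>2) =
      (\<Sum>i<n. of_nat q * (\<Sum>x\<in>words n q. line_sum q i g x * cnj (g x)))"
    unfolding of_real_sum using L by (simp del: of_real_power)
  also have "\<dots> = of_nat q * (\<Sum>x\<in>words n q. \<Sum>i<n. line_sum q i g x * cnj (g x))"
    by (subst sum.swap) (simp add: sum_distrib_left)
  also have "\<dots> = 0" using z by (simp flip: sum_distrib_right)
  finally have "(\<Sum>i<n. \<Sum>x\<in>words n q. (cmod (line_sum q i g x))\<^sup>2) = 0"
    by (simp only: of_real_eq_0_iff)
  then have "\<forall>i\<in>{..<n}. (\<Sum>x\<in>words n q. (cmod (line_sum q i g x))\<^sup>2) = 0"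
    by (subst (asm) sum_nonneg_eq_0_iff) (auto intro: sum_nonneg)
  then have "(\<Sum>x\<in>words n q. (cmod (line_sum q i g x))\<^sup>2) = 0" using i by blast
  then have "\<forall>x\<in>words n q. (cmod (line_sum q i g x))\<^sup>2 = 0"
    by (subst (asm) sum_nonneg_eq_0_iff) auto
  then show ?thesis using x by simp
qed

section \<open>Counting cylinders: the weight\<close>

lemma card_index_minus_le_1:
  assumes "D \<subseteq> {..<n}"
  shows "card {i. i < n \<and> card (D - {i}) \<le> 1} =
    (if card D \<le> 1 then n else if card D = 2 then 2 else 0)"
proof -
  have f: "finite D" using assms finite_subset by blast
  consider "card D \<le> 1" | "card D = 2" | "card D \<ge> 3" by linarith
  then show ?thesis
  proof cases
    case 1
    then have "card (D - {i}) \<le> 1" for i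
      using card_Diff1_le[of D i] by (rule order.trans[rotated])
    then show ?thesis using 1 by simp
  next
    case 2
    \<comment> \<open>Two differences drop to one exactly when the discarded position is one of
      them; this is the source of the factor 2 in the weight.\<close>
    then have "{i. i < n \<and> card (D - {i}) \<le> 1} = D"
      using assms f by (auto simp: card_Diff_singleton_if)
    then show ?thesis using 2 by simp
  next
    case 3
    then have "\<not> card (D - {i}) \<le> 1" for i
      using f by (auto simp: card_Diff_singleton_if)
    then show ?thesis using 3 by simp
  qed
qed

text \<open>Double counting of pairs of a direction and a word of \<open>Z\<close> in the
  corresponding cylinder: a word at distance 0 or 1 from \<open>x\<close> lies in all
  \<open>n\<close> cylinders around \<open>x\<close>, one at distance 2 in two of them, a farther
  one in none.\<close>

lemma weight_eq_sum_cylinder: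
  assumes x: "x \<in> words n q" and Z: "Z \<subseteq> words n q" and n: "n \<ge> 1"
  shows "real n * weight n q Z x = (\<Sum>i<n. real (card (cylinder n q x i \<inter> Z)))"
proof -
  have fZ: "finite Z" using finite_subset[OF Z finite_words] .
  have s: "real (card (hsphere n q k x \<inter> Z)) = (\<Sum>z\<in>Z. if card (diff_pos x z) = k then 1 else 0)" for k
  proof -
    have "hsphere n q k x \<inter> Z = {z\<in>Z. card (diff_pos x z) = k}"
      using Z by (auto simp: hsphere_def hdist_diff_pos)
    then show ?thesis using fZ by (simp flip: sum.inter_filter)
  qed
  have c: "real (card (cylinder n q x i \<inter> Z)) = (\<Sum>z\<in>Z. if card (diff_pos x z - {i}) \<le> 1 then 1 else 0)"
    if "i < n" for i
  proof -
    have "cylinder n q x i \<inter> Z = {z\<in>Z. card (diff_pos x z - {i}) \<le> 1}"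
      using Z cylinder_eq[OF x that] by auto
    then show ?thesis using fZ by (simp flip: sum.inter_filter)
  qed
  have "(\<Sum>i<n. real (card (cylinder n q x i \<inter> Z))) =
      (\<Sum>z\<in>Z. \<Sum>i<n. if card (diff_pos x z - {i}) \<le> 1 then 1 else 0)"
    by (subst sum.swap) (simp add: c)
  also have "\<dots> = (\<Sum>z\<in>Z. real (card {i. i < n \<and> card (diff_pos x z - {i}) \<le> 1}))"
    by (simp add: sum.If_cases Int_def conj_commute)
  also have "\<dots> = (\<Sum>z\<in>Z. real n * (if card (diff_pos x z) = 0 then 1 else 0)
     + real n * (if card (diff_pos x z) = 1 then 1 else 0) + 2 * (if card (diff_pos x z) = 2 then 1 else 0))"
  proof (rule sum.cong[OF refl])
    fix z
    have "diff_pos x z \<subseteq> {..<n}" using diff_pos_subset[of x z] length_words[OF x] by simp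
    from card_index_minus_le_1[OF this]
    show "real (card {i. i < n \<and> card (diff_pos x z - {i}) \<le> 1}) =
      real n * (if card (diff_pos x z) = 0 then 1 else 0)
     + real n * (if card (diff_pos x z) = 1 then 1 else 0) + 2 * (if card (diff_pos x z) = 2 then 1 else 0)"
      by (auto simp: le_Suc_eq simp del: card_0_eq)
  qed
  also have "\<dots> = real n * weight n q Z x"
    unfolding weight_def s sum.distrib sum_distrib_left[symmetric] using n
    by (simp add: distrib_left)
  finally show ?thesis by simp
qed

section \<open>Code distance 4 in terms of cylinders\<close>

lemma card_2_le: "finite A \<Longrightarrow> x \<in> A \<Longrightarrow> y \<in> A \<Longrightarrow> x \<noteq> y \<Longrightarrow> 2 \<le> card A"
  using card_mono[of A "{x, y}"] by auto

lemma card_le_1I: "(\<And>x y. x \<in> A \<Longrightarrow> y \<in> A \<Longrightarrow> x = y) \<Longrightarrow> card A \<le> 1"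
  by (cases "finite A") (auto simp: card_le_Suc0_iff_eq)

text \<open>Two words of one cylinder differ from \<open>x\<close> outside \<open>i\<close> in at
  most one position each, so their mutual distance is at most 3.\<close>

lemma code_cylinder_card_le_1:
  assumes C: "code_with_distance 4 Z" and x: "x \<in> words n q" and i: "i < n"
  shows "card (cylinder n q x i \<inter> Z) \<le> 1"
proof (rule card_le_1I, rule ccontr)
  fix y z assume y: "y \<in> cylinder n q x i \<inter> Z" and z: "z \<in> cylinder n q x i \<inter> Z" and "y \<noteq> z"
  then have "4 \<le> card (diff_pos y z)" using C by (auto simp: code_with_distance_def hdist_diff_pos)
  moreover have len: "length y = length x" "length z = length x"
    using y z x by (auto simp: cylinder_eq[OF x i] length_words)
  have "diff_pos y z \<subseteq> insert i ((diff_pos x y - {i}) \<union> (diff_pos x z - {i}))"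
    using diff_pos_triangle[of y x z] diff_pos_commute[of x y] len by auto
  then have "card (diff_pos y z) \<le> card (insert i ((diff_pos x y - {i}) \<union> (diff_pos x z - {i})))"
    by (rule card_mono[rotated]) auto
  also have "\<dots> \<le> Suc (card ((diff_pos x y - {i}) \<union> (diff_pos x z - {i})))"
    by (rule card_insert_le_m1) auto
  also have "\<dots> \<le> Suc (card (diff_pos x y - {i}) + card (diff_pos x z - {i}))"
    using card_Un_le by simp
  also have "\<dots> \<le> 3" using y z by (auto simp: cylinder_eq[OF x i])
  ultimately show False by simp
qed

lemma ball_in_cylinder:
  assumes x: "x \<in> words n q" and i: "i < n" and "y \<in> words n q" "card (diff_pos x y) \<le> 1"
  shows "y \<in> cylinder n q x i"
  using assms card_Diff1_le[of "diff_pos x y" i] by (simp add: cylinder_eq)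

text \<open>Choose a differing position \<open>i\<close> as the direction. If another differing
  position \<open>j\<close> exists, move \<open>x\<close> one step towards \<open>y\<close> at
  \<open>j\<close>; then at most one difference outside \<open>i\<close> is left. Otherwise
  \<open>x\<close> itself serves as the centre.\<close>

lemma close_words_share_cylinder:
  assumes x: "x \<in> words n q" and y: "y \<in> words n q" and "x \<noteq> y" and "card (diff_pos x y) \<le> 3"
  obtains z i where "z \<in> words n q" "i < n" "card (diff_pos z x) \<le> 1" "y \<in> cylinder n q z i"
proof -
  have len: "length x = n" "length y = n" using x y by (auto simp: length_words)
  have ne: "diff_pos x y \<noteq> {}" using \<open>x \<noteq> y\<close> len diff_pos_empty_iff by auto
  then obtain i where i: "i \<in> diff_pos x y" by auto
  then have "i < n" using diff_pos_subset len by blast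
  have c: "card (diff_pos x y - {i}) \<le> 2" using i assms by simp
  show ?thesis
  proof (cases "diff_pos x y - {i} = {}")
    case True
    then have "card (diff_pos x y - {i}) \<le> 1" by (simp only: card.empty)
    then show ?thesis using that[OF x \<open>i < n\<close>] y by (simp add: cylinder_eq[OF x \<open>i < n\<close>])
  next
    case False
    then obtain j where j: "j \<in> diff_pos x y - {i}" by auto
    then have "j < n" using diff_pos_subset len by blast
    define z where "z = x[j := y ! j]"
    have z: "z \<in> words n q" using x y \<open>j < n\<close> by (simp add: z_def update_words nth_words)
    have "diff_pos z x \<subseteq> {j}" unfolding z_def using \<open>j < n\<close> len by (auto simp: diff_pos_update)
    then have "card (diff_pos z x) \<le> 1" using card_mono[of "{j}"] by simp
    moreover have "card (diff_pos z y - {i}) \<le> 1"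
    proof -
      have "diff_pos z y - {i} = diff_pos x y - {i} - {j}"
        unfolding z_def using \<open>j < n\<close> len by (auto simp: diff_pos_update)
      then show ?thesis using j c by simp
    qed
    ultimately show ?thesis using that[OF z \<open>i < n\<close>] y by (simp add: cylinder_eq[OF z \<open>i < n\<close>])
  qed
qed

text \<open>The bound is asked only for centres within distance 1 of a word of \<open>Z\<close>.
  This suits (D3), which controls just the sum of the counts: around such a centre every cylinder
  already meets \<open>Z\<close>.\<close>

lemma codeI_cylinder:
  assumes Z: "Z \<subseteq> words n q"
    and c: "\<And>x i z. x \<in> words n q \<Longrightarrow> i < n \<Longrightarrow> z \<in> Z \<Longrightarrow> card (diff_pos x z) \<le> 1
       \<Longrightarrow> card (cylinder n q x i \<inter> Z) \<le> 1"
  shows "code_with_distance 4 Z"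
  unfolding code_with_distance_def hdist_diff_pos
proof (intro ballI impI, rule ccontr)
  fix x y assume xy: "x \<in> Z" "y \<in> Z" "x \<noteq> y" "\<not> 4 \<le> card (diff_pos x y)"
  then obtain z i where z: "z \<in> words n q" "i < n" "card (diff_pos z x) \<le> 1" "y \<in> cylinder n q z i"
    using close_words_share_cylinder[of x n q y] Z by (auto simp: subset_iff)
  have "x \<in> cylinder n q z i" using ball_in_cylinder z xy Z by blast
  then have "2 \<le> card (cylinder n q z i \<inter> Z)"
    using z xy by (intro card_2_le) auto
  then show False using c[OF z(1,2) xy(1) z(3)] by simp
qed

lemma sum_char_fun:
  assumes "finite C" "Tp \<inter> Tm = {}"
  shows "(\<Sum>z\<in>C. char_fun Tp Tm z) = of_nat (card (C \<inter> Tp)) - of_nat (card (C \<inter> Tm))"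
proof -
  have "(\<Sum>z\<in>C. char_fun Tp Tm z) = (\<Sum>z\<in>C. (if z \<in> Tp then 1 else 0) - (if z \<in> Tm then 1 else 0))"
    using assms(2) by (intro sum.cong) (auto simp: char_fun_def)
  then show ?thesis using assms(1) by (simp add: sum_subtractf sum.If_cases Int_def)
qed

section \<open>Deleting and inserting a coordinate\<close>

definition delete_at :: "nat \<Rightarrow> word \<Rightarrow> word" where
  "delete_at i x = take i x @ drop (Suc i) x"

lemma delete_at_words: "x \<in> words n q \<Longrightarrow> i < n \<Longrightarrow> delete_at i x \<in> words (n - 1) q"
  using set_take_subset[of i x] set_drop_subset[of "Suc i" x]
  by (auto simp: words_def delete_at_def)

lemma insert_at_words: "y \<in> words (n - 1) q \<Longrightarrow> i < n \<Longrightarrow> a < q \<Longrightarrow> insert_at i a y \<in> words n q"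
  using set_take_subset[of i y] set_drop_subset[of i y]
  by (auto simp: words_def insert_at_def)

lemma insert_at_delete_at: "i < length x \<Longrightarrow> insert_at i (x ! i) (delete_at i x) = x"
  by (simp add: insert_at_def delete_at_def id_take_nth_drop[symmetric])

lemma delete_at_insert_at: "i \<le> length y \<Longrightarrow> delete_at i (insert_at i a y) = y"
  by (simp add: insert_at_def delete_at_def)

lemma nth_delete_at:
  "i < length x \<Longrightarrow> k < length x - 1 \<Longrightarrow> delete_at i x ! k = x ! (if k < i then k else Suc k)"
  by (auto simp: delete_at_def nth_append)

lemma card_diff_pos_delete_at:
  assumes len: "length x = length z" and i: "i < length x"
  shows "card (diff_pos (delete_at i x) (delete_at i z)) = card (diff_pos x z - {i})"
proof -
  \<comment> \<open>\<open>?s\<close> sends a position of the shortened word to the position it came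
    from, skipping \<open>i\<close>.\<close>
  let ?s = "\<lambda>k. if k < i then k else Suc k"
  have "diff_pos x z - {i} = ?s ` diff_pos (delete_at i x) (delete_at i z)"
  proof (intro equalityI subsetI)
    fix k assume k: "k \<in> diff_pos x z - {i}"
    define k' where "k' = (if k < i then k else k - 1)"
    have "?s k' = k" "k' < length x - 1"
      using k i by (auto simp: k'_def diff_pos_def)
    moreover from this have "k' \<in> diff_pos (delete_at i x) (delete_at i z)"
      using k i len by (auto simp: diff_pos_def nth_delete_at) (auto simp: delete_at_def)
    ultimately show "k \<in> ?s ` diff_pos (delete_at i x) (delete_at i z)" by force
  next
    fix k assume "k \<in> ?s ` diff_pos (delete_at i x) (delete_at i z)"
    then obtain k' where k': "k = ?s k'" "k' < length (delete_at i x)"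
      "delete_at i x ! k' \<noteq> delete_at i z ! k'"
      unfolding diff_pos_def by blast
    have "k' < length x - 1" using k'(2) i by (simp add: delete_at_def)
    then show "k \<in> diff_pos x z - {i}"
      using k'(1,3) i len nth_delete_at[of i x k'] nth_delete_at[of i z k']
      by (auto simp: diff_pos_def)
  qed
  moreover have "inj ?s" by (auto simp: inj_def)
  ultimately show ?thesis by (metis card_image inj_on_subset subset_UNIV)
qed

text \<open>\<open>delete_at i\<close> is a bijection between the two sets. It is injective on
  \<open>Z\<close> because words with the same image differ at most at \<open>i\<close>, and
  differences outside \<open>i\<close> become the distance in the smaller graph.\<close>

lemma card_cylinder_eq_card_ball_proj:
  assumes Z: "Z \<subseteq> words n q" and C: "code_with_distance 4 Z"
    and x: "x \<in> words n q" and i: "i < n"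
  shows "card (cylinder n q x i \<inter> Z) = card (hball (n - 1) q (delete_at i x) \<inter> proj n q i Z)"
proof (rule bij_betw_same_card[of "delete_at i"], unfold bij_betw_def, intro conjI equalityI subsetI)
  show "inj_on (delete_at i) (cylinder n q x i \<inter> Z)"
  proof (rule inj_onI, rule ccontr)
    fix y z assume yz: "y \<in> cylinder n q x i \<inter> Z" "z \<in> cylinder n q x i \<inter> Z"
      "delete_at i y = delete_at i z" "y \<noteq> z"
    have len: "length y = n" "length z = n" using yz Z length_words by blast+
    have "card (diff_pos y z - {i}) = 0"
      using card_diff_pos_delete_at[of y z i] len i yz(3) by simp
    then have "card (diff_pos y z) \<le> 1"
      using card_mono[of "{i}" "diff_pos y z"] by auto
    moreover have "4 \<le> card (diff_pos y z)"
      using C yz by (simp add: code_with_distance_def hdist_diff_pos)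
    ultimately show False by simp
  qed
next
  fix y assume "y \<in> delete_at i ` (cylinder n q x i \<inter> Z)"
  then obtain z where y: "y = delete_at i z" and z: "z \<in> cylinder n q x i" "z \<in> Z" by blast
  have zW: "z \<in> words n q" using z Z by blast
  have "insert_at i (z ! i) y = z"
    using insert_at_delete_at[of i z] i length_words[OF zW] y by simp
  then have "y \<in> proj n q i Z"
    using z zW nth_words[OF zW i] delete_at_words[OF zW i] y by (auto simp: proj_def)
  moreover have "y \<in> hball (n - 1) q (delete_at i x)"
    using z delete_at_words[OF zW i] card_diff_pos_delete_at[of x z i] i
      length_words[OF zW] length_words[OF x]
    by (simp add: y hball_def hdist_diff_pos cylinder_eq[OF x i])
  ultimately show "y \<in> hball (n - 1) q (delete_at i x) \<inter> proj n q i Z" by blast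
next
  fix y assume y: "y \<in> hball (n - 1) q (delete_at i x) \<inter> proj n q i Z"
  then obtain a where yW: "y \<in> words (n - 1) q" and a: "a < q" "insert_at i a y \<in> Z"
    by (auto simp: proj_def)
  have zW: "insert_at i a y \<in> words n q" using insert_at_words[OF yW i a(1)] .
  have del: "delete_at i (insert_at i a y) = y"
    using i length_words[OF yW] by (simp add: delete_at_insert_at)
  have "insert_at i a y \<in> cylinder n q x i"
    using y zW card_diff_pos_delete_at[of x "insert_at i a y" i] i
      length_words[OF zW] length_words[OF x]
    by (simp add: del hball_def hdist_diff_pos cylinder_eq[OF x i])
  then show "y \<in> delete_at i ` (cylinder n q x i \<inter> Z)" using a del by force
qed

text \<open>The three columns of \<open>F S\<close>. In \<open>A F = F S\<close>, column 0
  identifies the second column of \<open>F\<close> with \<open>A f\<close>, and zero row sums then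
  determine the third.\<close>

lemma S_matrix_simps:
  "mat_prod {..<3} F (S_matrix n q) x 0 = F x 1"
  "mat_prod {..<3} F (S_matrix n q) x 1 =
     of_nat n * (of_nat q - 1) * F x 0 + (of_nat q - 2) * F x 1 + of_nat n * F x 2"
  "mat_prod {..<3} F (S_matrix n q) x 2 =
     (of_nat n - 1) * (of_nat q - 1) * F x 1 + of_nat n * (of_nat q - 2) * F x 2"
  by (simp_all add: mat_prod_def S_matrix_def Let_def eval_nat_numeral lessThan_Suc algebra_simps)

section \<open>The five conditions and their common form\<close>

locale signed_pair =
  fixes n q :: nat and Tp Tm :: "word set"
  assumes q: "q \<ge> 3" and n: "n \<ge> 1"
    and Tp: "Tp \<subseteq> words n q" and Tm: "Tm \<subseteq> words n q" and disj: "Tp \<inter> Tm = {}"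
begin

abbreviation f :: "word \<Rightarrow> complex" where "f \<equiv> char_fun Tp Tm"

definition codes :: bool where
  "codes \<longleftrightarrow> code_with_distance 4 Tp \<and> code_with_distance 4 Tm"

definition balanced :: bool where
  "balanced \<longleftrightarrow> (\<forall>x\<in>words n q. (\<Sum>i<n. \<Sum>z\<in>cylinder n q x i. f z) = 0)"

text \<open>The equation \<open>(A + n) (A - (q - 2)) f = 0\<close>, solved for
  \<open>A (A f)\<close>.\<close>

lemma balanced_quadratic:
  "balanced \<longleftrightarrow> (\<forall>x\<in>words n q. adj_op n q (adj_op n q f) x =
     (of_nat q - 2 - of_nat n) * adj_op n q f x + of_nat n * (of_nat q - 2) * f x)"
proof -
  have "(\<Sum>i<n. \<Sum>z\<in>cylinder n q x i. f z) = 0 \<longleftrightarrow> adj_op n q (adj_op n q f) x =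
     (of_nat q - 2 - of_nat n) * adj_op n q f x + of_nat n * (of_nat q - 2) * f x"
    if "x \<in> words n q" for x
    unfolding sum_cylinder_sum[OF that] by (simp add: algebra_simps)
  then show ?thesis by (simp add: balanced_def)
qed

lemma D5_iff: "D5 n q Tp Tm \<longleftrightarrow> codes \<and> balanced"
proof
  assume D5: "D5 n q Tp Tm"
  then have "codes"
    unfolding codes_def D5_def by (auto intro!: codeI_cylinder[OF Tp] codeI_cylinder[OF Tm])
  moreover have "balanced"
    using D5 by (auto simp: balanced_def D5_def sum_char_fun[OF _ disj])
  ultimately show "codes \<and> balanced" by blast
next
  assume cb: "codes \<and> balanced"
  let ?G = "\<lambda>y. adj_op n q f y - (of_nat q - 2) * f y"
  have G: "(\<Sum>i<n. line_sum q i ?G x) = 0" if "x \<in> words n q" for x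
    using cb that by (simp add: balanced_def line_sum_shifted_adj_op)
  show "D5 n q Tp Tm" unfolding D5_def
  proof (intro ballI allI impI conjI)
    fix x i assume x: "x \<in> words n q" and i: "i < n"
    have "(\<Sum>z\<in>cylinder n q x i. f z) = 0"
      using line_sum_eq_0[OF G x i] line_sum_shifted_adj_op[OF x i] by simp
    then show "card (cylinder n q x i \<inter> Tp) = card (cylinder n q x i \<inter> Tm)"
      by (simp add: sum_char_fun[OF _ disj])
    show "card (cylinder n q x i \<inter> Tm) \<le> 1"
      using cb code_cylinder_card_le_1[OF _ x i] by (simp add: codes_def)
  qed
qed

text \<open>A word of \<open>Z\<close> within distance 1 of \<open>x\<close> lies in all
  \<open>n\<close> cylinders around \<open>x\<close>. If one of them held a second word of
  \<open>Z\<close>, the counts would sum to more than \<open>n\<close>, so the weight would exceed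
  1.\<close>

lemma code_if_weight_le_1:
  assumes Z: "Z \<subseteq> words n q" and w: "\<And>x. x \<in> words n q \<Longrightarrow> weight n q Z x \<le> 1"
  shows "code_with_distance 4 Z"
proof (rule codeI_cylinder[OF Z], rule ccontr)
  fix x i z assume x: "x \<in> words n q" and i: "i < n" and z: "z \<in> Z" "card (diff_pos x z) \<le> 1"
    and c: "\<not> card (cylinder n q x i \<inter> Z) \<le> 1"
  have "1 \<le> real (card (cylinder n q x j \<inter> Z))" if "j < n" for j
  proof -
    have "z \<in> cylinder n q x j \<inter> Z" using ball_in_cylinder[OF x that] z Z by blast
    then have "card (cylinder n q x j \<inter> Z) \<noteq> 0" by (auto simp: card_eq_0_iff)
    then show ?thesis by linarith
  qed
  then have "(\<Sum>j<n. 1) < (\<Sum>j<n. real (card (cylinder n q x j \<inter> Z)))"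
    using c i by (intro sum_strict_mono_ex1) (auto intro!: bexI[of _ i])
  then have "real n < real n * weight n q Z x"
    using weight_eq_sum_cylinder[OF x Z n] by simp
  also have "\<dots> \<le> real n" using w[OF x] by (simp add: mult_left_le)
  finally show False by simp
qed

lemma D3_iff: "D3 n q Tp Tm \<longleftrightarrow> codes \<and> balanced"
proof -
  have eq: "weight n q Tp x = weight n q Tm x \<longleftrightarrow> (\<Sum>i<n. \<Sum>z\<in>cylinder n q x i. f z) = 0"
    if x: "x \<in> words n q" for x
  proof -
    have "(\<Sum>i<n. \<Sum>z\<in>cylinder n q x i. f z) =
      of_real (real n * weight n q Tp x - real n * weight n q Tm x)"
      unfolding weight_eq_sum_cylinder[OF x Tp n] weight_eq_sum_cylinder[OF x Tm n]
      by (simp add: sum_char_fun[OF _ disj] sum_subtractf)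
    then show ?thesis using n by (simp flip: right_diff_distrib)
  qed
  have "weight n q Tm x \<le> 1" if "codes" and x: "x \<in> words n q" for x
  proof -
    have "real n * weight n q Tm x \<le> (\<Sum>i<n. 1)"
      unfolding weight_eq_sum_cylinder[OF x Tm n] using that
      by (intro sum_mono) (use code_cylinder_card_le_1[of Tm x n q] in \<open>auto simp: codes_def\<close>)
    then show ?thesis using n by simp
  qed
  moreover have "codes" if "D3 n q Tp Tm"
    using that unfolding codes_def D3_def
    by (auto intro!: code_if_weight_le_1[OF Tp] code_if_weight_le_1[OF Tm])
  ultimately show ?thesis using eq by (auto simp: D3_def balanced_def)
qed

lemma D4_iff: "D4 n q Tp Tm \<longleftrightarrow> codes \<and> balanced"
proof -
  \<comment> \<open>\<open>c\<close> is the difference of the eigenvalues \<open>q - 2\<close> and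
    \<open>- n\<close>; it is nonzero, so the two eigencomponents of \<open>f\<close> can be
    separated.\<close>
  define c :: complex where "c = of_nat n + of_nat q - 2"
  have "c = of_nat (n + q - 2)" unfolding c_def using n q by (simp add: of_nat_diff)
  then have c0: "c \<noteq> 0" using n q by (simp only: of_nat_eq_0_iff)
  define d where "d = 1 / c"
  have "balanced" if gh: "\<forall>x\<in>words n q. f x = g x + h x"
      "\<forall>x\<in>words n q. adj_op n q g x = - of_nat n * g x"
      "\<forall>x\<in>words n q. adj_op n q h x = (of_nat q - 2) * h x" for g h
  proof -
    have Af: "adj_op n q f x = - of_nat n * g x + (of_nat q - 2) * h x" if "x \<in> words n q" for x
      using adj_op_cong[of n q f "\<lambda>x. g x + h x"] gh that by (simp add: adj_op_add)
    have AA: "adj_op n q (adj_op n q f) x =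
        - of_nat n * (- of_nat n * g x) + (of_nat q - 2) * ((of_nat q - 2) * h x)"
      if "x \<in> words n q" for x
      using adj_op_cong[of n q "adj_op n q f", OF Af] gh that
      unfolding adj_op_add adj_op_scale by simp
    show ?thesis unfolding balanced_quadratic
    proof
      fix x assume x: "x \<in> words n q"
      then have fx: "f x = g x + h x" using gh by blast
      \<comment> \<open>Both eigenvalues are roots of
        \<open>t * t = (q - 2 - n) * t + n * (q - 2)\<close>.\<close>
      show "adj_op n q (adj_op n q f) x =
        (of_nat q - 2 - of_nat n) * adj_op n q f x + of_nat n * (of_nat q - 2) * f x"
        unfolding AA[OF x] Af[OF x] fx by (simp add: algebra_simps)
    qed
  qed
  moreover have "\<exists>g h :: word \<Rightarrow> complex.
        (\<forall>x\<in>words n q. f x = g x + h x) \<and>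
        (\<forall>x\<in>words n q. adj_op n q g x = - of_nat n * g x) \<and>
        (\<forall>x\<in>words n q. adj_op n q h x = (of_nat q - 2) * h x)" if b: "balanced"
  proof (intro exI conjI ballI)
    \<comment> \<open>The Lagrange interpolation formulas for the spectral projections: each factor
      of the quadratic, normalised by \<open>c\<close>, isolates the eigencomponent that the other
      factor annihilates.\<close>
    let ?g = "\<lambda>x. d * ((of_nat q - 2) * f x - adj_op n q f x)"
    let ?h = "\<lambda>x. d * (adj_op n q f x + of_nat n * f x)"
    fix x assume x: "x \<in> words n q"
    have AA: "adj_op n q (adj_op n q f) x =
       (of_nat q - 2 - of_nat n) * adj_op n q f x + of_nat n * (of_nat q - 2) * f x"
      using b x unfolding balanced_quadratic by blast
    have "?g x + ?h x =
        d * (((of_nat q - 2) * f x - adj_op n q f x) + (adj_op n q f x + of_nat n * f x))"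
      by (rule distrib_left[symmetric])
    also have "\<dots> = d * (c * f x)"
      by (simp add: c_def algebra_simps)
    finally have "?g x + ?h x = d * (c * f x)" .
    then show "f x = ?g x + ?h x" using c0 by (simp add: d_def)
    show "adj_op n q ?g x = - of_nat n * ?g x"
      unfolding adj_op_scale adj_op_diff AA by (simp add: algebra_simps)
    show "adj_op n q ?h x = (of_nat q - 2) * ?h x"
      unfolding adj_op_scale adj_op_add AA by (simp add: algebra_simps)
  qed
  ultimately show ?thesis unfolding D4_def codes_def by blast
qed

text \<open>A word of \<open>Tp\<close> has no neighbour in \<open>Tp\<close> by the code distance,
  and at most one in \<open>Tm\<close> because its ball lies in a cylinder; likewise with the roles
  exchanged. This supplies the zero entry required in each row of \<open>F\<close>.\<close>

lemma adj_op_char_fun_on_support: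
  assumes codes and x: "x \<in> words n q" and fx: "f x \<noteq> 0"
  shows "adj_op n q f x = 0 \<or> adj_op n q f x = - f x"
proof -
  define N where "N = {y \<in> words n q. adj x y}"
  have "adj_op n q f x = (\<Sum>y\<in>N. f y)"
    unfolding adj_op_def N_def adj_matrix_def by (subst sum.inter_filter) (auto intro!: sum.cong)
  then have A: "adj_op n q f x = of_nat (card (N \<inter> Tp)) - of_nat (card (N \<inter> Tm))"
    by (simp add: sum_char_fun[OF _ disj] N_def)
  have empty: "N \<inter> Z = {}" if "code_with_distance 4 Z" "x \<in> Z" for Z
  proof -
    have "x \<noteq> y \<and> hdist x y = 1" if "y \<in> N" for y
      using that by (auto simp: N_def adj_diff_pos hdist_diff_pos)
    then show ?thesis using that by (fastforce simp: code_with_distance_def)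
  qed
  have le: "card (N \<inter> Z) \<le> 1" if "code_with_distance 4 Z" for Z
  proof -
    have "N \<subseteq> cylinder n q x 0"
      using ball_in_cylinder[OF x, of 0] n by (auto simp: N_def adj_diff_pos)
    then have "card (N \<inter> Z) \<le> card (cylinder n q x 0 \<inter> Z)" by (intro card_mono) auto
    also have "\<dots> \<le> 1" using code_cylinder_card_le_1[OF that x, of 0] n by simp
    finally show ?thesis .
  qed
  have 01: "card (N \<inter> Z) = 0 \<or> card (N \<inter> Z) = 1" if "code_with_distance 4 Z" for Z
    using le[OF that] by linarith
  from fx consider "x \<in> Tp" "f x = 1" | "x \<in> Tm" "f x = - 1"
    by (auto simp: char_fun_def split: if_splits)
  then show ?thesis
    using A empty[of Tp] empty[of Tm] 01[of Tp] 01[of Tm] \<open>codes\<close>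
    by cases (auto simp: codes_def)
qed

text \<open>The columns of \<open>F\<close> can only be \<open>f\<close>, \<open>A f\<close> and
  \<open>- f - A f\<close>. Column 1 of \<open>A F = F S\<close> then becomes the quadratic equation
  for \<open>f\<close>, and column 2 is consistent with it because all rows of \<open>S\<close> have
  the same sum \<open>n * (q - 1)\<close>.\<close>

lemma D1_iff: "D1 n q Tp Tm \<longleftrightarrow> codes \<and> balanced"
proof -
  have prod: "mat_prod (words n q) adj_matrix F x j = adj_op n q (\<lambda>y. F y j) x"
    for F :: "word \<Rightarrow> nat \<Rightarrow> complex" and x j
    by (simp add: mat_prod_def adj_op_def)
  have j3: "(\<forall>j<3. P j) \<longleftrightarrow> P 0 \<and> P 1 \<and> P 2" for P :: "nat \<Rightarrow> bool"
    by (auto simp: less_Suc_eq eval_nat_numeral)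
  have s3: "(\<Sum>j<3. u j) = u 0 + u 1 + u 2" for u :: "nat \<Rightarrow> complex"
    by (simp add: eval_nat_numeral)
  have "balanced" if F0: "\<forall>x\<in>words n q. F x 0 = f x"
      and F: "\<forall>x\<in>words n q. (\<Sum>j<3. F x j) = 0 \<and> card {j. j < 3 \<and> F x j \<noteq> 0} \<le> 2"
      and AF: "\<forall>x\<in>words n q. \<forall>j<3.
         mat_prod (words n q) adj_matrix F x j = mat_prod {..<3} F (S_matrix n q) x j" for F
  proof -
    have F1: "adj_op n q f x = F x 1" if "x \<in> words n q" for x
      using AF that adj_op_cong[of n q "\<lambda>y. F y 0" f x] F0
      unfolding j3 S_matrix_simps prod by simp
    have F2: "F x 2 = - f x - F x 1" if "x \<in> words n q" for x
      using F F0 that unfolding s3 by (metis add.commute add_eq_0_iff diff_conv_add_uminus minus_add)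
    have "adj_op n q (adj_op n q f) x =
       of_nat n * (of_nat q - 1) * f x + (of_nat q - 2) * F x 1 + of_nat n * (- f x - F x 1)"
      if "x \<in> words n q" for x
      using AF that adj_op_cong[of n q "adj_op n q f" "\<lambda>y. F y 1" x, OF F1] F0 F2
      unfolding j3 S_matrix_simps prod by simp
    then show ?thesis unfolding balanced_quadratic using F1 by (simp add: algebra_simps)
  qed
  moreover have "\<exists>F :: word \<Rightarrow> nat \<Rightarrow> complex.
        (\<forall>x\<in>words n q. F x 0 = f x) \<and>
        (\<forall>x\<in>words n q. (\<Sum>j<3. F x j) = 0 \<and> card {j. j < 3 \<and> F x j \<noteq> 0} \<le> 2) \<and>
        (\<forall>x\<in>words n q. \<forall>j<3.
           mat_prod (words n q) adj_matrix F x j = mat_prod {..<3} F (S_matrix n q) x j)"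
    if c: codes and b: balanced
  proof -
    define F :: "word \<Rightarrow> nat \<Rightarrow> complex" where
      "F x j = (if j = 0 then f x else if j = 1 then adj_op n q f x else - f x - adj_op n q f x)"
      for x j
    have F: "F x 0 = f x" "F x 1 = adj_op n q f x" "F x 2 = - f x - adj_op n q f x" for x
      by (auto simp: F_def)
    have "card {j. j < 3 \<and> F x j \<noteq> 0} \<le> 2" if x: "x \<in> words n q" for x
    proof -
      \<comment> \<open>The vanishing column is 0 off the support of \<open>f\<close>; on the
        support it is 1 or 2, according to whether \<open>A f\<close> is 0 or
        \<open>- f\<close>.\<close>
      obtain k where k: "k < 3" "F x k = 0"
      proof (cases "f x = 0")
        case True
        then show ?thesis using that[of 0] F by simp
      next
        case False
        with adj_op_char_fun_on_support[OF c x] show ?thesis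
          using that[of 1] that[of 2] F by auto
      qed
      then have "{j. j < 3 \<and> F x j \<noteq> 0} \<subseteq> {..<3} - {k}" by auto
      then have "card {j. j < 3 \<and> F x j \<noteq> 0} \<le> card ({..<3} - {k})" by (intro card_mono) auto
      then show ?thesis using k by simp
    qed
    moreover have "(\<Sum>j<3. F x j) = 0" for x unfolding s3 F by simp
    moreover have "\<forall>j<3. mat_prod (words n q) adj_matrix F x j = mat_prod {..<3} F (S_matrix n q) x j"
      if "x \<in> words n q" for x
    proof -
      have AA: "adj_op n q (adj_op n q f) x =
         (of_nat q - 2 - of_nat n) * adj_op n q f x + of_nat n * (of_nat q - 2) * f x"
        using b that unfolding balanced_quadratic by blast
      show ?thesis unfolding j3 prod S_matrix_simps F adj_op_diff adj_op_uminus AA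
        by (simp add: algebra_simps)
    qed
    ultimately show ?thesis using F(1) by blast
  qed
  ultimately show ?thesis unfolding D1_def codes_def by blast
qed

text \<open>Removing the common part of the two projections lowers both ball counts equally, so
  their equality is unaffected. The counts for the full projections are cylinder counts, and the
  bound by 1 comes from the code distance.\<close>

lemma perfect_bitrade_proj_iff:
  assumes c: codes and i: "i < n"
  shows "perfect_bitrade (n - 1) q (proj_pair n q i (Tp, Tm)) \<longleftrightarrow>
    (\<forall>x\<in>words n q. card (cylinder n q x i \<inter> Tp) = card (cylinder n q x i \<inter> Tm))"
proof -
  let ?W = "words (n - 1) q" and ?B = "hball (n - 1) q"
  let ?P = "proj n q i Tp" and ?M = "proj n q i Tm"
  have cyl: "card (cylinder n q x i \<inter> Tp) = card (?B (delete_at i x) \<inter> ?P)"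
    "card (cylinder n q x i \<inter> Tm) = card (?B (delete_at i x) \<inter> ?M)" if "x \<in> words n q" for x
    using card_cylinder_eq_card_ball_proj[OF _ _ that i] Tp Tm c by (auto simp: codes_def)
  \<comment> \<open>Inserting the letter 0 gives a preimage, so every centre in the smaller graph
    comes from a cylinder.\<close>
  have surj: "\<exists>x\<in>words n q. y = delete_at i x" if "y \<in> ?W" for y
    using insert_at_words[OF that i, of 0] q i length_words[OF that]
    by (intro bexI[of _ "insert_at i 0 y"]) (auto simp: delete_at_insert_at)
  have all: "(\<forall>x\<in>words n q. Q (delete_at i x)) \<longleftrightarrow> (\<forall>y\<in>?W. Q y)" for Q
    using surj delete_at_words[OF _ i] by blast
  have fin: "finite (?B y)" for y by (simp add: hball_def)
  have split: "card (?B y \<inter> A) = card (?B y \<inter> (A - A')) + card (?B y \<inter> A \<inter> A')" for y A A'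
  proof -
    have "?B y \<inter> A = ?B y \<inter> (A - A') \<union> ?B y \<inter> A \<inter> A'" by auto
    then show ?thesis
      by (metis (no_types, lifting) Diff_disjoint Int_assoc Int_commute Int_empty_right card_Un_disjoint fin finite_Int inf_left_commute)
  qed
  have eq: "card (?B y \<inter> (?P - ?M)) = card (?B y \<inter> (?M - ?P)) \<longleftrightarrow>
      card (?B y \<inter> ?P) = card (?B y \<inter> ?M)" for y
    using split[of y ?P ?M] split[of y ?M ?P] by (simp add: Int_ac)
  have "card (?B y \<inter> ?M) \<le> 1" if "y \<in> ?W" for y
  proof -
    obtain x where x: "x \<in> words n q" "y = delete_at i x" using surj[OF \<open>y \<in> ?W\<close>] by blast
    then show ?thesis
      using cyl(2)[of x] code_cylinder_card_le_1[of Tm x n q i] c i by (simp add: codes_def)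
  qed
  then have le: "card (?B y \<inter> (?M - ?P)) \<le> 1" if "y \<in> ?W" for y
    using split[of y ?M ?P] that by fastforce
  have "perfect_bitrade (n - 1) q (proj_pair n q i (Tp, Tm)) \<longleftrightarrow>
      (\<forall>y\<in>?W. card (?B y \<inter> ?P) = card (?B y \<inter> ?M))"
    unfolding perfect_bitrade_def proj_pair_def using eq le by (auto simp: proj_def)
  also have "\<dots> \<longleftrightarrow> (\<forall>x\<in>words n q. card (cylinder n q x i \<inter> Tp) = card (cylinder n q x i \<inter> Tm))"
    using all[of "\<lambda>y. card (?B y \<inter> ?P) = card (?B y \<inter> ?M)"] cyl by simp
  finally show ?thesis .
qed

text \<open>For codes of distance 4 the bound in (D5) is automatic, so only the equalities of
  cylinder counts remain to be compared.\<close>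

lemma D2_iff: "D2 n q Tp Tm \<longleftrightarrow> codes \<and> balanced"
proof -
  have "D2 n q Tp Tm \<longleftrightarrow> codes \<and>
    (\<forall>i<n. \<forall>x\<in>words n q. card (cylinder n q x i \<inter> Tp) = card (cylinder n q x i \<inter> Tm))"
    unfolding D2_def using perfect_bitrade_proj_iff by (auto simp: codes_def)
  also have "\<dots> \<longleftrightarrow> codes \<and> D5 n q Tp Tm"
    unfolding D5_def using code_cylinder_card_le_1[of Tm] by (auto simp: codes_def)
  finally show ?thesis using D5_iff by blast
qed

end

theorem theorem1:
  fixes n q :: nat and Tp Tm :: "word set"
  assumes "q \<ge> 3" and "n \<ge> 1"
    and "Tp \<subseteq> words n q" and "Tm \<subseteq> words n q" and "Tp \<inter> Tm = {}"
  shows "(D1 n q Tp Tm \<longleftrightarrow> D2 n q Tp Tm) \<and> (D1 n q Tp Tm \<longleftrightarrow> D3 n q Tp Tm) \<and>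
    (D1 n q Tp Tm \<longleftrightarrow> D4 n q Tp Tm) \<and> (D1 n q Tp Tm \<longleftrightarrow> D5 n q Tp Tm)"
proof -
  interpret signed_pair n q Tp Tm using assms by unfold_locales
  show ?thesis by (simp add: D1_iff D2_iff D3_iff D4_iff D5_iff)
qed

end
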